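(* Let $\beta>\alpha>0$ and $x,y\in(0,1)$, and put $$U=\frac{\beta x-\alpha y}{\beta-\alpha},\qquad V=\frac{\beta x-\alpha(1-y)}{\beta-\alpha}.$$ Assume $U,V\in(0,1)$. Then $$\max\bigl\{\sin^{\beta-\alpha}(\pi U),\ \sin^{\beta-\alpha}(\pi V)\bigr\}\leq\frac{\sin^\beta(\pi x)}{\sin^\alpha(\pi y)}.$$ Moreover, $$\sin(\pi U)\geq\sin(\pi V)\iff(1-2y)(2x-1)\leq0.$$
   Context: Here $\sin^{c}(t)$ denotes $(\sin t)^c$. *)

theory Defs
  imports Complex_Main
begin

end

(* The function t \<mapsto> ln (sin (pi t)) is concave on (0,1), and x is the convex combination of y and U
   with weights \<alpha>/\<beta> and 1 - \<alpha>/\<beta>; replacing y by 1 - y turns U into V and leaves sin (pi y) unchanged.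
   The comparison of sin (pi U) and sin (pi V) is read off the signs of the two factors of
   sin a - sin b = 2 sin ((a - b)/2) cos ((a + b)/2). *)
theory Submission
  imports Defs "HOL-Analysis.Convex"
begin

lemma sin_pi_pos: "0 < sin (pi * t)" if "t \<in> {0<..<1}" for t :: real
  using that by (intro sin_gt_zero) auto

text \<open>The second derivative is the square of \<open>pi / sin (pi * t)\<close>, hence
  nonnegative.\<close>

lemma convex_on_minus_ln_sin: "convex_on {0<..<1} (\<lambda>t. - ln (sin (pi * t)))"
proof (rule f''_ge0_imp_convex)
  show "((\<lambda>t. - ln (sin (pi * t))) has_real_derivative - (pi * cot (pi * t))) (at t)"
    if "t \<in> {0<..<1}" for t
    using sin_pi_pos[OF that] by (auto intro!: derivative_eq_intros simp: cot_def field_simps)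
  show "((\<lambda>t. - (pi * cot (pi * t))) has_real_derivative (pi / sin (pi * t))\<^sup>2) (at t)"
    if "t \<in> {0<..<1}" for t
    using sin_pi_pos[OF that]
    by (auto intro!: derivative_eq_intros DERIV_chain2[OF DERIV_cot]
        simp: field_simps power2_eq_square)
qed auto

lemma sin_powr_le_quotient:
  fixes \<alpha> \<beta> x y u :: real
  assumes "0 < \<alpha>" "\<alpha> < \<beta>" and I: "x \<in> {0<..<1}" "y \<in> {0<..<1}" "u \<in> {0<..<1}"
    and u: "u = (\<beta> * x - \<alpha> * y) / (\<beta> - \<alpha>)"
  shows "sin (pi * u) powr (\<beta> - \<alpha>) \<le> sin (pi * x) powr \<beta> / sin (pi * y) powr \<alpha>"
proof -
  note pos = I[THEN sin_pi_pos]
  have x: "x = (1 - \<alpha> / \<beta>) * u + (\<alpha> / \<beta>) * y"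
    using assms by (simp add: field_simps)
  \<comment> \<open>Jensen's inequality; the weight \<alpha> / \<beta> lies in (0,1) because 0 <
    \<alpha> < \<beta>.\<close>
  have "- ln (sin (pi * x)) \<le> (1 - \<alpha> / \<beta>) * - ln (sin (pi * u)) + (\<alpha> / \<beta>) * - ln (sin (pi * y))"
    using convex_onD[OF convex_on_minus_ln_sin, of "\<alpha> / \<beta>" u y] assms unfolding x by simp
  then have "(\<beta> - \<alpha>) * ln (sin (pi * u)) + \<alpha> * ln (sin (pi * y)) \<le> \<beta> * ln (sin (pi * x))"
    using assms(1,2) by (simp add: field_simps)
  \<comment> \<open>Exponentiating gives the powers, as all three sines are positive.\<close>
  then have "exp ((\<beta> - \<alpha>) * ln (sin (pi * u))) \<le> exp (\<beta> * ln (sin (pi * x)) - \<alpha> * ln (sin (pi * y)))"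
    by simp
  then show ?thesis
    using pos by (simp add: powr_def exp_diff)
qed

text \<open>The argument lies strictly between -pi/2 and pi/2, where sine is odd and positive on the
  positive side.\<close>

lemma sgn_sin_half_pi: "sgn (sin (pi * t / 2)) = sgn t" if "\<bar>t\<bar> < 1" for t :: real
proof -
  have "0 < sin (pi * s / 2)" if "0 < s" "s < 1" for s :: real
    using sin_pi_pos[of "s / 2"] that by simp
  from this[of t] this[of "- t"] that show ?thesis
    by (cases t "0 :: real" rule: linorder_cases) (auto simp: sgn_if)
qed

theorem corollary4p3:
  fixes \<alpha> \<beta> x y U V :: real
  assumes "0 < \<alpha>" and "\<alpha> < \<beta>"
    and "x \<in> {0<..<1}" and "y \<in> {0<..<1}"
    and "U = (\<beta> * x - \<alpha> * y) / (\<beta> - \<alpha>)"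
    and "V = (\<beta> * x - \<alpha> * (1 - y)) / (\<beta> - \<alpha>)"
    and "U \<in> {0<..<1}" and "V \<in> {0<..<1}"
  shows "max (sin (pi * U) powr (\<beta> - \<alpha>)) (sin (pi * V) powr (\<beta> - \<alpha>))
           \<le> sin (pi * x) powr \<beta> / sin (pi * y) powr \<alpha>
       \<and> (sin (pi * U) \<ge> sin (pi * V) \<longleftrightarrow> (1 - 2 * y) * (2 * x - 1) \<le> 0)"
proof
  have "sin (pi * (1 - y)) = sin (pi * y)"
    by (simp add: right_diff_distrib sin_diff)
  then show "max (sin (pi * U) powr (\<beta> - \<alpha>)) (sin (pi * V) powr (\<beta> - \<alpha>))
           \<le> sin (pi * x) powr \<beta> / sin (pi * y) powr \<alpha>"
    using sin_powr_le_quotient[of \<alpha> \<beta> x y U] sin_powr_le_quotient[of \<alpha> \<beta> x "1 - y" V] assms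
    by simp
next
  \<comment> \<open>Up to positive factors, the two half-angle arguments are governed by 1 - 2 * y
    and 1 - 2 * x separately.\<close>
  have diff: "U - V = \<alpha> / (\<beta> - \<alpha>) * (1 - 2 * y)" and sum: "1 - (U + V) = \<beta> / (\<beta> - \<alpha>) * (1 - 2 * x)"
    using assms(1,2) unfolding assms(5,6) by (simp_all add: divide_simps, algebra+)
  \<comment> \<open>Writing the cosine as a sine lets \<open>sgn_sin_half_pi\<close> give the sign
    of both factors.\<close>
  have "cos (pi * (U + V) / 2) = sin (pi * (1 - (U + V)) / 2)"
    by (simp add: cos_sin_eq algebra_simps diff_divide_distrib)
  then have "sin (pi * U) - sin (pi * V) = 2 * sin (pi * (U - V) / 2) * sin (pi * (1 - (U + V)) / 2)"
    by (simp add: sin_diff_sin flip: distrib_left right_diff_distrib)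
  \<comment> \<open>U, V in (0,1) force -1 < U - V < 1 and 0 < U + V < 2.\<close>
  moreover have "\<bar>U - V\<bar> < 1" "\<bar>1 - (U + V)\<bar> < 1"
    using assms(7,8) by auto
  ultimately have "sgn (sin (pi * U) - sin (pi * V)) = sgn (U - V) * sgn (1 - (U + V))"
    using sgn_sin_half_pi[of "U - V"] sgn_sin_half_pi[of "1 - (U + V)"]
    by (simp add: sgn_mult)
  \<comment> \<open>The factors \<alpha> / (\<beta> - \<alpha>) and \<beta> / (\<beta> - \<alpha>)
    are positive and drop out of the sign.\<close>
  also have "\<dots> = sgn ((1 - 2 * y) * (1 - 2 * x))"
    using assms(1,2) unfolding diff sum by (simp add: sgn_mult)
  finally have "0 \<le> sin (pi * U) - sin (pi * V) \<longleftrightarrow> 0 \<le> (1 - 2 * y) * (1 - 2 * x)"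
    by (metis zero_le_sgn_iff)
  also have "\<dots> \<longleftrightarrow> (1 - 2 * y) * (2 * x - 1) \<le> 0"
    by (simp add: algebra_simps)
  finally show "sin (pi * U) \<ge> sin (pi * V) \<longleftrightarrow> (1 - 2 * y) * (2 * x - 1) \<le> 0"
    by simp
qed

end
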